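(* For integers $k\ge 1$ and $n>1$ let $$F_k(n):=\sigma_k^{(-1)}(n)+\mu(n)+J_k(n)+3,\qquad R_k(n):=\sum_{\substack{d\mid n\\ 1<d<n}}\bigl(\mu(d)+J_k(d)\bigr),$$ where an empty sum is $0$. Then for every integer $k\geq 1$ and every integer $n>1$, $$F_k(n)+R_k(n)=\sigma_k^{(-1)}(n)+n^k+1.$$ Consequently, $$F_k(n)+R_k(n)=0\quad\Longleftrightarrow\quad n\text{ is prime}.$$
   Context: For arithmetic functions $f,g:\{1,2,3,\ldots\}\to\mathbb{Z}$, the Dirichlet convolution is $(f*g)(n)=\sum_{d\mid n}f(d)g(n/d)$, with identity $\varepsilon$ given by $\varepsilon(1)=1$ and $\varepsilon(n)=0$ for $n>1$. If $f(1)\neq 0$, then $f^{(-1)}$ denotes the Dirichlet inverse of $f$ (not the pointwise reciprocal), i.e. the unique arithmetic function with $f*f^{(-1)}=\varepsilon$. For an integer $k\ge 1$, $\sigma_k(n)=\sum_{d\mid n}d^k$, and $\sigma_k^{(-1)}$ is its Dirichlet inverse. $\mu$ is the Möbius function. The $k$th Jordan totient function is $J_k(n)=\sum_{d\mid n}\mu(n/d)d^k=n^k\prod_{p\mid n}(1-p^{-k})$, the product being over primes $p$ dividing $n$. *)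

theory Defs
  imports "HOL-Computational_Algebra.Computational_Algebra"
begin

(* Arithmetic functions live on the positive integers; here they are functions on nat
   whose value at 0 is irrelevant. *)

definition dirichlet_conv :: "(nat \<Rightarrow> 'a::comm_ring_1) \<Rightarrow> (nat \<Rightarrow> 'a) \<Rightarrow> nat \<Rightarrow> 'a" where
  "dirichlet_conv f g n = (\<Sum>d | d dvd n. f d * g (n div d))"

definition dirichlet_unit :: "nat \<Rightarrow> 'a::comm_ring_1" where
  "dirichlet_unit n = (if n = 1 then 1 else 0)"

(* The condition g 0 = 0 only pins down the irrelevant value at 0, so that g is unique.
   Over a general ring the inverse exists iff f 1 is a unit, see ex1_dirichlet_inverse. *)
definition dirichlet_inverse :: "(nat \<Rightarrow> 'a::comm_ring_1) \<Rightarrow> nat \<Rightarrow> 'a" where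
  "dirichlet_inverse f =
     (THE g. g 0 = 0 \<and> (\<forall>n>0. dirichlet_conv f g n = dirichlet_unit n))"

definition sigma :: "nat \<Rightarrow> nat \<Rightarrow> int" where
  "sigma k n = (\<Sum>d | d dvd n. int d ^ k)"

definition moebius :: "nat \<Rightarrow> int" where
  "moebius n = (if squarefree n then (-1) ^ card (prime_factors n) else 0)"

definition jordan_totient :: "nat \<Rightarrow> nat \<Rightarrow> int" where
  "jordan_totient k n = (\<Sum>d | d dvd n. moebius (n div d) * int d ^ k)"

definition F :: "nat \<Rightarrow> nat \<Rightarrow> int" where
  "F k n = dirichlet_inverse (sigma k) n + moebius n + jordan_totient k n + 3"

definition R :: "nat \<Rightarrow> nat \<Rightarrow> int" where
  "R k n = (\<Sum>d | d dvd n \<and> 1 < d \<and> d < n. moebius d + jordan_totient k d)"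


lemma dirichlet_conv_split:
  assumes "n > 0"
  shows "dirichlet_conv f g n =
           f 1 * g n + (\<Sum>d | d dvd n \<and> d \<noteq> 1. f d * g (n div d))"
proof -
  have "{d. d dvd n} = insert 1 {d. d dvd n \<and> d \<noteq> 1}" by auto
  moreover have "finite {d. d dvd n \<and> d \<noteq> 1}"
    using finite_divisors_nat[OF assms] by (rule finite_subset[rotated]) auto
  ultimately show ?thesis by (simp add: dirichlet_conv_def)
qed

(* Only a witness for the existence part of ex1_dirichlet_inverse. *)
function dirichlet_inverse_rec :: "(nat \<Rightarrow> 'a::comm_ring_1) \<Rightarrow> 'a \<Rightarrow> nat \<Rightarrow> 'a" where
  "dirichlet_inverse_rec f u n =
     (if n = 0 then 0 else
        u * (dirichlet_unit n -
             sum (\<lambda>d. if d dvd n \<and> d \<noteq> 1 \<and> n \<noteq> 0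
                      then f d * dirichlet_inverse_rec f u (n div d) else 0) {..n}))"
  by auto
termination
  by (relation "Wellfounded.measure (\<lambda>(f, u, n). n)")
     (auto intro!: div_less_dividend simp: nat_neq_iff)

declare dirichlet_inverse_rec.simps [simp del]

lemma ex1_dirichlet_inverse:
  fixes f :: "nat \<Rightarrow> 'a::comm_ring_1"
  assumes "f 1 dvd 1"
  shows "\<exists>!g. g 0 = 0 \<and> (\<forall>n>0. dirichlet_conv f g n = dirichlet_unit n)"
proof -
  from assms obtain u where u: "f 1 * u = 1" by (metis dvdE)
  define h where "h = dirichlet_inverse_rec f u"
  have h: "h n = u * (dirichlet_unit n - (\<Sum>d | d dvd n \<and> d \<noteq> 1. f d * h (n div d)))"
    if "n > 0" for n
  proof -
    have "(\<Sum>d\<le>n. if d dvd n \<and> d \<noteq> 1 \<and> n \<noteq> 0 then f d * h (n div d) else 0) =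
          (\<Sum>d | d dvd n \<and> d \<noteq> 1. f d * h (n div d))"
      using that by (intro sum.mono_neutral_cong_right) (auto dest: dvd_imp_le)
    with that show ?thesis
      unfolding h_def by (subst dirichlet_inverse_rec.simps) simp
  qed
  show ?thesis
  proof (rule ex1I[of _ h])
    have "dirichlet_conv f h n = dirichlet_unit n" if "n > 0" for n
    proof -
      have "f 1 * h n = dirichlet_unit n - (\<Sum>d | d dvd n \<and> d \<noteq> 1. f d * h (n div d))"
        using u by (subst h[OF that]) (simp add: mult.assoc[symmetric])
      thus ?thesis by (simp add: dirichlet_conv_split[OF that])
    qed
    moreover have "h 0 = 0" by (simp add: h_def dirichlet_inverse_rec.simps)
    ultimately show "h 0 = 0 \<and> (\<forall>n>0. dirichlet_conv f h n = dirichlet_unit n)" by blast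
  next
    fix g assume g: "g 0 = 0 \<and> (\<forall>n>0. dirichlet_conv f g n = dirichlet_unit n)"
    have "g n = h n" for n
    proof (induction n rule: less_induct)
      case (less n)
      show ?case
      proof (cases "n = 0")
        case True
        thus ?thesis using g by (simp add: h_def dirichlet_inverse_rec.simps)
      next
        case False
        have "(\<Sum>d | d dvd n \<and> d \<noteq> 1. f d * g (n div d)) =
              (\<Sum>d | d dvd n \<and> d \<noteq> 1. f d * h (n div d))"
        proof (rule sum.cong)
          fix d assume "d \<in> {d. d dvd n \<and> d \<noteq> 1}"
          with False have "n div d < n" by (cases "d = 0") (auto intro!: div_less_dividend)
          thus "f d * g (n div d) = f d * h (n div d)" using less by simp
        qed simp
        moreover have "f 1 * g n + (\<Sum>d | d dvd n \<and> d \<noteq> 1. f d * g (n div d)) = dirichlet_unit n"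
          using g False dirichlet_conv_split[of n f g] by simp
        ultimately have "f 1 * g n =
            dirichlet_unit n - (\<Sum>d | d dvd n \<and> d \<noteq> 1. f d * h (n div d))"
          by (simp add: algebra_simps)
        hence "u * (f 1 * g n) = h n" using False by (simp add: h)
        moreover have "u * (f 1 * g n) = g n"
          using u by (metis mult.assoc mult.commute mult_1)
        ultimately show ?thesis by simp
      qed
    qed
    thus "g = h" by blast
  qed
qed

lemma dirichlet_inverse_sigma:
  "dirichlet_inverse (sigma k) 0 = 0"
  "n > 0 \<Longrightarrow> dirichlet_conv (sigma k) (dirichlet_inverse (sigma k)) n = dirichlet_unit n"
proof -
  have "sigma k 1 dvd 1" by (simp add: sigma_def)
  from theI'[OF ex1_dirichlet_inverse[of "sigma k", OF this]]
  show "dirichlet_inverse (sigma k) 0 = 0"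
    "n > 0 \<Longrightarrow> dirichlet_conv (sigma k) (dirichlet_inverse (sigma k)) n = dirichlet_unit n"
    unfolding dirichlet_inverse_def by blast+
qed

end

theory Submission
  imports Defs
begin

text \<open>
  Summing over all divisors, \<open>\<mu>\<close> contributes \<open>0\<close> (as \<open>n > 1\<close>) and \<open>J\<^sub>k\<close> contributes
  \<open>n\<^sup>k\<close>. The terms at \<open>d = 1\<close> are both \<open>1\<close>, so the divisors \<open>d > 1\<close> contribute
  \<open>n\<^sup>k - 2\<close>, and the constant \<open>3\<close> in \<open>F\<close> makes this \<open>n\<^sup>k + 1\<close>. That is the identity.

  It remains to see when \<open>\<sigma>\<^sub>k\<close> has the inverse value \<open>-(n\<^sup>k + 1)\<close>. As \<open>\<sigma>\<^sub>k\<close> is the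
  convolution of \<open>1\<close> and \<open>d\<^sup>k\<close>, its inverse is that of \<open>\<mu>(d) d\<^sup>k\<close> and \<open>\<mu>\<close>
  (\<open>dirichlet_inverse_sigma_eq\<close>). There are two cases.

  If \<open>n\<close> is squarefree, the inverse is \<open>\<mu>(n) \<sigma>\<^sub>k(n)\<close>
  (\<open>dirichlet_inverse_sigma_squarefree\<close>). For prime \<open>n\<close> this is \<open>-(n\<^sup>k + 1)\<close>, whereas a
  composite \<open>n\<close> has a third divisor, so the absolute value exceeds \<open>n\<^sup>k + 1\<close>.

  If \<open>p\<^sup>2\<close> divides \<open>n\<close> for a prime \<open>p\<close>, a size estimate does not suffice: at \<open>k = 1\<close>,
  \<open>n = 4 * 3 * 5 * 7 * 11 * 13 = 60060\<close> the inverse is \<open>-64512\<close>, which is less than \<open>-(n + 1)\<close>.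
  But \<open>p\<close> divides the inverse (\<open>prime_dvd_dirichlet_inverse_sigma\<close>) as well as \<open>n\<^sup>k\<close>, so the
  sum of the inverse and \<open>n\<^sup>k + 1\<close> is \<open>1\<close> modulo \<open>p\<close> and cannot vanish.
\<close>

section \<open>The ring of arithmetic functions\<close>

lemma dirichlet_conv_0 [simp]: "dirichlet_conv f g 0 = 0"
  by (simp add: dirichlet_conv_def)

lemma dirichlet_conv_commute: "dirichlet_conv f g = dirichlet_conv g f"
proof
  fix n
  show "dirichlet_conv f g n = dirichlet_conv g f n"
  proof (cases "n = 0")
    case False
    then show ?thesis
      unfolding dirichlet_conv_def
      by (intro sum.reindex_bij_witness[of _ "\<lambda>d. n div d" "\<lambda>d. n div d"])
         (auto simp: mult.commute)
  qed simp
qed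

lemma dirichlet_conv_assoc:
  "dirichlet_conv (dirichlet_conv f g) h = dirichlet_conv f (dirichlet_conv g h)"
proof
  fix n
  show "dirichlet_conv (dirichlet_conv f g) h n = dirichlet_conv f (dirichlet_conv g h) n"
  proof (cases "n = 0")
    case False
    then have fin: "finite {d. d dvd m}" if "m dvd n" for m
      using that by (auto intro: finite_divisors_nat dvd_pos_nat)
    have "dirichlet_conv (dirichlet_conv f g) h n =
        (\<Sum>(d, e)\<in>(SIGMA d:{d. d dvd n}. {e. e dvd d}). f e * g (d div e) * h (n div d))"
      unfolding dirichlet_conv_def sum_distrib_right
      by (subst sum.Sigma) (auto simp: fin)
    \<comment> \<open>Both sides run over the factorisations of \<open>n\<close> into three factors: \<open>e\<close>, \<open>d / e\<close>, \<open>n / d\<close>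
      above, and \<open>d\<close>, \<open>e\<close>, \<open>n / (d e)\<close> below.\<close>
    also have "\<dots> = (\<Sum>(d, e)\<in>(SIGMA d:{d. d dvd n}. {e. e dvd n div d}).
                      f d * (g e * h (n div d div e)))"
      using False
      by (intro sum.reindex_bij_witness[of _ "\<lambda>(d, e). (d * e, d)" "\<lambda>(d, e). (e, d div e)"])
         (auto simp: mult.assoc div_mult2_eq elim!: dvdE)
    also have "\<dots> = dirichlet_conv f (dirichlet_conv g h) n"
      unfolding dirichlet_conv_def sum_distrib_left
      by (subst sum.Sigma) (auto simp: fin div_dvd_iff_mult)
    finally show ?thesis .
  qed simp
qed

lemma dirichlet_conv_unit_right:
  assumes "n > 0"
  shows "dirichlet_conv f dirichlet_unit n = f n"
proof -
  have "dirichlet_conv f dirichlet_unit n = dirichlet_conv dirichlet_unit f n"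
    by (simp add: dirichlet_conv_commute)
  also have "\<dots> = f n"
    using assms by (simp add: dirichlet_conv_split dirichlet_unit_def)
  finally show ?thesis .
qed

text \<open>Since a convolution vanishes at \<open>0\<close>, equality of functions requires \<open>f 0 = 0\<close>.\<close>

lemma dirichlet_conv_unit_left:
  assumes "f 0 = 0"
  shows "dirichlet_conv dirichlet_unit f = f"
proof
  show "dirichlet_conv dirichlet_unit f n = f n" for n
    using assms dirichlet_conv_unit_right[of n f]
    by (cases "n = 0") (auto simp: dirichlet_conv_commute)
qed

lemma dirichlet_inverse_eqI:
  assumes "f 1 dvd 1" "g 0 = 0" "dirichlet_conv f g = dirichlet_unit"
  shows "dirichlet_inverse f = g"
  unfolding dirichlet_inverse_def
  using ex1_dirichlet_inverse[of f] assms by (intro the1_equality) auto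


section \<open>The Moebius function\<close>

lemma moebius_1 [simp]: "moebius (Suc 0) = 1"
  by (simp add: moebius_def)

lemma moebius_0 [simp]: "moebius 0 = 0"
  by (simp add: moebius_def)

lemma moebius_prime: "prime p \<Longrightarrow> moebius p = - 1"
  by (simp add: moebius_def squarefree_prime prime_prime_factors)

lemma moebius_mult_coprime:
  assumes "coprime a b"
  shows "moebius (a * b) = moebius a * moebius b"
proof (cases "a = 0 \<or> b = 0")
  case False
  have "prime_factors a \<inter> prime_factors b = {}"
    using assms by (auto simp: in_prime_factors_iff dest: coprime_common_divisor not_prime_unit)
  then have "card (prime_factors (a * b)) = card (prime_factors a) + card (prime_factors b)"
    using False by (simp add: prime_factors_product card_Un_disjoint)
  then show ?thesis
    using assms by (simp add: moebius_def power_add)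
      (metis squarefree_mult_coprime squarefree_multD)
qed auto

lemma moebius_not_squarefree:
  assumes "\<not> squarefree n"
  shows "moebius n = 0"
  using assms by (simp add: moebius_def)

lemma moebius_prime_mult:
  assumes "prime p"
  shows "moebius (p * d) = (if p dvd d then 0 else - moebius d)"
proof (cases "p dvd d")
  case True
  then have "p ^ 2 dvd p * d"
    by (simp add: power2_eq_square)
  with assms have "\<not> squarefree (p * d)"
    by (meson not_prime_unit squarefree_def)
  with True show ?thesis
    by (simp add: moebius_not_squarefree)
next
  case False
  with assms show ?thesis
    by (simp add: moebius_mult_coprime prime_imp_coprime moebius_prime)
qed

text \<open>
  Fix a prime \<open>p\<close> dividing \<open>n\<close>. The divisors \<open>d\<close> prime to \<open>p\<close> cancel against the divisors
  \<open>p d\<close>, and the divisors that \<open>p\<^sup>2\<close> divides contribute \<open>0\<close>.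
\<close>

lemma dirichlet_conv_one_moebius: "dirichlet_conv (\<lambda>_. 1) moebius = dirichlet_unit"
proof
  fix n
  show "dirichlet_conv (\<lambda>_. 1) moebius n = dirichlet_unit n"
  proof (cases "n \<le> 1")
    case True
    then show ?thesis
      by (cases "n = 0") (auto simp: dirichlet_conv_def dirichlet_unit_def le_Suc_eq)
  next
    case False
    then obtain p where p: "prime p" "p dvd n"
      using prime_factor_nat[of n] by auto
    then obtain m where m: "n = p * m" by (elim dvdE)
    have "m > 0" "p > 0" using False m by (auto intro: Nat.gr0I)
    have fin: "finite {d. d dvd n}" using False by simp
    have "d dvd m \<longleftrightarrow> d dvd n" if "\<not> p dvd d" for d
      using that p(1) unfolding m
      by (metis coprime_commute coprime_dvd_mult_right_iff prime_imp_coprime)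
    then have eq: "{d. d dvd m \<and> \<not> p dvd d} = {d. d dvd n \<and> \<not> p dvd d}"
      by auto
    have "dirichlet_conv (\<lambda>_. 1) moebius n = (\<Sum>d | d dvd n. moebius d)"
      by (subst dirichlet_conv_commute) (simp add: dirichlet_conv_def)
    also have "{d. d dvd n} = {d. d dvd n \<and> \<not> p dvd d} \<union> {d. d dvd n \<and> p dvd d}"
      by auto
    also have "(\<Sum>d\<in>\<dots>. moebius d) =
        (\<Sum>d | d dvd n \<and> \<not> p dvd d. moebius d) + (\<Sum>d | d dvd n \<and> p dvd d. moebius d)"
      using fin by (intro sum.union_disjoint) (auto elim: rev_finite_subset)
    also have "(\<Sum>d | d dvd n \<and> p dvd d. moebius d) = (\<Sum>d | d dvd m. moebius (p * d))"
      using \<open>p > 0\<close> unfolding m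
      by (intro sum.reindex_bij_witness[of _ "\<lambda>d. p * d" "\<lambda>d. d div p"]) auto
    also have "\<dots> = (\<Sum>d | d dvd m \<and> \<not> p dvd d. - moebius d)"
      using \<open>m > 0\<close> p(1)
      by (intro sum.mono_neutral_cong_right) (auto simp: moebius_prime_mult)
    finally show ?thesis
      using False by (simp add: eq sum_negf dirichlet_unit_def)
  qed
qed

lemma sum_moebius_divisors:
  assumes "n > 1"
  shows "(\<Sum>d | d dvd n. moebius d) = 0"
proof -
  have "(\<Sum>d | d dvd n. moebius d) = dirichlet_conv (\<lambda>_. 1) moebius n"
    by (subst dirichlet_conv_commute) (simp add: dirichlet_conv_def)
  then show ?thesis
    using assms by (simp add: dirichlet_conv_one_moebius dirichlet_unit_def)
qed

lemma sum_jordan_totient_divisors: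
  assumes "n > 0"
  shows "(\<Sum>d | d dvd n. jordan_totient k d) = int n ^ k"
proof -
  have J: "jordan_totient k = dirichlet_conv (\<lambda>d. int d ^ k) moebius"
    by (simp add: fun_eq_iff jordan_totient_def dirichlet_conv_def mult.commute)
  have "(\<Sum>d | d dvd n. jordan_totient k d) = dirichlet_conv (jordan_totient k) (\<lambda>_. 1) n"
    by (simp add: dirichlet_conv_def)
  also have "\<dots> = dirichlet_conv (\<lambda>d. int d ^ k) (dirichlet_conv (\<lambda>_. 1) moebius) n"
    by (simp add: J dirichlet_conv_assoc dirichlet_conv_commute[of moebius])
  also have "\<dots> = int n ^ k"
    using assms by (simp add: dirichlet_conv_one_moebius dirichlet_conv_unit_right)
  finally show ?thesis .
qed


section \<open>The Dirichlet inverse of the divisor power sum\<close>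

text \<open>The function \<open>d\<^sup>k\<close> is completely multiplicative, so twisting by it preserves inverses.\<close>

lemma dirichlet_conv_power_moebius_power:
  "dirichlet_conv (\<lambda>d. int d ^ k) (\<lambda>d. moebius d * int d ^ k) = dirichlet_unit"
proof
  fix n
  have "dirichlet_conv (\<lambda>d. int d ^ k) (\<lambda>d. moebius d * int d ^ k) n =
      int n ^ k * dirichlet_conv (\<lambda>_. 1) moebius n"
    unfolding dirichlet_conv_def sum_distrib_left
  proof (rule sum.cong)
    fix d assume "d \<in> {d. d dvd n}"
    then have "int d * int (n div d) = int n"
      by (metis dvd_mult_div_cancel mem_Collect_eq of_nat_mult)
    then have "int n ^ k = int d ^ k * int (n div d) ^ k"
      by (simp flip: power_mult_distrib)
    then show "int d ^ k * (moebius (n div d) * int (n div d) ^ k) =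
        int n ^ k * (1 * moebius (n div d))"
      by simp
  qed simp
  then show "dirichlet_conv (\<lambda>d. int d ^ k) (\<lambda>d. moebius d * int d ^ k) n = dirichlet_unit n"
    by (simp add: dirichlet_conv_one_moebius dirichlet_unit_def)
qed

lemma dirichlet_inverse_sigma_eq:
  "dirichlet_inverse (sigma k) = dirichlet_conv (\<lambda>d. moebius d * int d ^ k) moebius"
proof (rule dirichlet_inverse_eqI)
  let ?P = "\<lambda>d. int d ^ k" and ?N = "\<lambda>d. moebius d * int d ^ k"
  show "sigma k 1 dvd 1"
    by (simp add: sigma_def)
  have "sigma k = dirichlet_conv ?P (\<lambda>_. 1)"
    by (simp add: fun_eq_iff sigma_def dirichlet_conv_def)
  also have "\<dots> = dirichlet_conv (\<lambda>_. 1) ?P"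
    by (rule dirichlet_conv_commute)
  finally have "dirichlet_conv (sigma k) (dirichlet_conv ?N moebius) =
      dirichlet_conv (\<lambda>_. 1) (dirichlet_conv (dirichlet_conv ?P ?N) moebius)"
    by (simp add: dirichlet_conv_assoc)
  then show "dirichlet_conv (sigma k) (dirichlet_conv ?N moebius) = dirichlet_unit"
    by (simp add: dirichlet_conv_power_moebius_power dirichlet_conv_unit_left
        dirichlet_conv_one_moebius)
qed simp

text \<open>Complementary divisors of a squarefree number are coprime, so \<open>\<mu>(d) \<mu>(n / d) = \<mu>(n)\<close>.\<close>

lemma dirichlet_inverse_sigma_squarefree:
  assumes "squarefree n"
  shows "dirichlet_inverse (sigma k) n = moebius n * sigma k n"
  unfolding dirichlet_inverse_sigma_eq dirichlet_conv_def sigma_def sum_distrib_left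
proof (rule sum.cong)
  fix d assume "d \<in> {d. d dvd n}"
  then have n: "n = d * (n div d)" by simp
  have "coprime d (n div d)"
  proof (rule coprimeI)
    fix c assume "c dvd d" "c dvd n div d"
    then have "c ^ 2 dvd n"
      using n by (metis mult_dvd_mono power2_eq_square)
    with assms show "c dvd 1" by (rule squarefreeD)
  qed
  then have "moebius n = moebius d * moebius (n div d)"
    using n by (metis moebius_mult_coprime)
  then show "moebius d * int d ^ k * moebius (n div d) = moebius n * int d ^ k"
    by simp
qed simp

text \<open>
  A term of the convolution is nonzero only if \<open>d\<close> and \<open>n / d\<close> are squarefree; then neither
  can absorb all of \<open>p\<^sup>2\<close>, so \<open>p\<close> divides \<open>d\<close> and hence \<open>d\<^sup>k\<close>.
\<close>

lemma prime_dvd_dirichlet_inverse_sigma: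
  assumes "k \<ge> 1" "prime p" "p ^ 2 dvd n"
  shows "int p dvd dirichlet_inverse (sigma k) n"
  unfolding dirichlet_inverse_sigma_eq dirichlet_conv_def
proof (rule dvd_sum)
  fix d assume "d \<in> {d. d dvd n}"
  then have n: "n = d * (n div d)" by simp
  show "int p dvd moebius d * int d ^ k * moebius (n div d)"
  proof (cases "p dvd d")
    case True
    with assms(1) have "int p dvd int d ^ k"
      by (intro dvd_power_le[of "int p" "int d" 1 k, simplified]) auto
    then show ?thesis by simp
  next
    case False
    with assms(2) have "coprime (p ^ 2) d"
      by (simp add: prime_imp_coprime)
    with assms(3) n have "p ^ 2 dvd n div d"
      by (metis coprime_dvd_mult_right_iff)
    with assms(2) have "\<not> squarefree (n div d)"
      by (meson not_prime_unit squarefree_def)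
    then show ?thesis
      by (simp add: moebius_not_squarefree)
  qed
qed


section \<open>Values of the divisor power sum\<close>

lemma sigma_prime:
  assumes "prime p"
  shows "sigma k p = int p ^ k + 1"
proof -
  have "{d. d dvd p} = {1, p}"
    using assms by (auto simp: prime_nat_iff)
  moreover have "p \<noteq> 1" using assms by auto
  ultimately show ?thesis
    by (simp add: sigma_def)
qed

lemma sigma_composite_greater:
  assumes "n > 1" "\<not> prime n"
  shows "sigma k n > int n ^ k + 1"
proof -
  obtain d where d: "d dvd n" "d \<noteq> 1" "d \<noteq> n"
    using assms by (auto simp: prime_nat_iff)
  with assms have "d > 0" by (auto intro: Nat.gr0I)
  then have "int n ^ k + 1 < (\<Sum>d\<in>{1, d, n}. int d ^ k)"
    using d assms(1) by simp
  also have "\<dots> \<le> sigma k n"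
    unfolding sigma_def using d assms(1) by (intro sum_mono2) auto
  finally show ?thesis .
qed


section \<open>Characterisation of primes\<close>

lemma dirichlet_inverse_sigma_eq_iff_prime:
  assumes "k \<ge> 1" "n > 1"
  shows "dirichlet_inverse (sigma k) n + int n ^ k + 1 = 0 \<longleftrightarrow> prime n"
proof (cases "squarefree n")
  case True
  note inv = dirichlet_inverse_sigma_squarefree[OF True, of k]
  show ?thesis
  proof (cases "prime n")
    case True
    then show ?thesis
      by (simp add: inv sigma_prime moebius_prime)
  next
    case False
    have "moebius n = 1 \<or> moebius n = - 1"
      using \<open>squarefree n\<close> by (simp add: moebius_def uminus_power_if)
    then have "moebius n * sigma k n = sigma k n \<or> moebius n * sigma k n = - sigma k n"
      by auto
    moreover have "sigma k n > int n ^ k + 1"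
      using assms(2) False by (rule sigma_composite_greater)
    moreover have "int n ^ k \<ge> 0"
      by simp
    ultimately have "dirichlet_inverse (sigma k) n + int n ^ k + 1 \<noteq> 0"
      unfolding inv by linarith
    with False show ?thesis by simp
  qed
next
  case False
  then obtain p where p: "prime p" "p ^ 2 dvd n"
    using assms(2) squarefree_factorial_semiring[of n] by auto
  have "p dvd n"
    using p(2) by (metis dvd_mult_left power2_eq_square)
  with assms(1) have "int p dvd int n ^ k"
    by (intro dvd_power_le[of "int p" "int n" 1 k, simplified]) auto
  with prime_dvd_dirichlet_inverse_sigma[OF assms(1) p]
  have "int p dvd dirichlet_inverse (sigma k) n + int n ^ k"
    by simp
  moreover have "\<not> int p dvd 1"
    using p(1) by auto
  ultimately have "dirichlet_inverse (sigma k) n + int n ^ k + 1 \<noteq> 0"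
    by (metis dvd_0_right dvd_add_right_iff)
  moreover have "\<not> prime n"
    using False squarefree_prime by blast
  ultimately show ?thesis by simp
qed

theorem proposition5:
  fixes k n :: nat
  assumes "k \<ge> 1" and "n > 1"
  shows "F k n + R k n = dirichlet_inverse (sigma k) n + int n ^ k + 1 \<and>
         (F k n + R k n = 0 \<longleftrightarrow> prime n)"
proof -
  let ?g = "\<lambda>d. moebius d + jordan_totient k d"
  have "{d. d dvd n} = insert 1 (insert n {d. d dvd n \<and> 1 < d \<and> d < n})"
    using assms(2) by (auto dest: dvd_imp_le intro: Nat.gr0I)
  moreover have "finite {d. d dvd n \<and> 1 < d \<and> d < n}"
    by simp
  ultimately have "(\<Sum>d | d dvd n. ?g d) = ?g 1 + (?g n + R k n)"
    using assms(2) by (simp add: R_def)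
  moreover have "?g 1 = 2"
    by (simp add: jordan_totient_def)
  moreover have "(\<Sum>d | d dvd n. ?g d) = int n ^ k"
    using assms(2) by (simp add: sum.distrib sum_moebius_divisors sum_jordan_totient_divisors)
  ultimately have eq: "F k n + R k n = dirichlet_inverse (sigma k) n + int n ^ k + 1"
    by (simp add: F_def)
  then show ?thesis
    using dirichlet_inverse_sigma_eq_iff_prime[OF assms] by simp
qed

end
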